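(* Let $g:(0,\infty)\to[0,\infty)$ be a decreasing function and let $\alpha\in(0,1)$. Let $\mathcal{F}(g,\alpha)$ be the family of all decreasing functions $f:(0,\infty)\to[0,\infty)$ satisfying \[ f(r+s)\le g(r)+\alpha f(s)\quad\text{for all } r,s>0. \] Suppose that \[ \int_0^1\log^+ g(x)\,dx<\infty . \] Then \[ \sup_{f\in\mathcal{F}(g,\alpha)}f(x)<\infty\quad\text{for all } x\in(0,\infty). \] Moreover, define $F(x):=\sup_{f\in\mathcal{F}(g,\alpha)}f(x)$ for $x>0$ and $F(0):=\lim_{x\to0^+}F(x)$ (possibly $\infty$), let $I:=\{x\in(0,\infty):g(x)>0\}$, and let \[ G(x):=\int_0^x\log\frac{g(t)}{g(x)}\,dt\quad(x\in I). \] Then \[ F\Bigl(\frac{G(x)}{\log(1/\beta)}\Bigr)\le\frac{g(x-)}{\beta-\alpha}\quad\text{for all } x\in I \text{ and all } \beta\in(\alpha,1). \]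
   Context: "Decreasing" means non-increasing (not necessarily strictly). $\log^+(x):=\log\max\{x,1\}$. For $x>0$, $g(x-):=\lim_{y\to x^-}g(y)$. *)

theory Defs
  imports "HOL-Analysis.Analysis"
begin

text \<open>
  Functions on \<open>(0,\<infinity>)\<close> are represented by functions \<^typ>\<open>real \<Rightarrow> real\<close> that are only constrained
  on \<^term>\<open>{0<..} :: real set\<close>; their values elsewhere are never used.
\<close>

definition decreasing_nonneg :: "(real \<Rightarrow> real) \<Rightarrow> bool" where
  "decreasing_nonneg f \<longleftrightarrow> (\<forall>x>0. 0 \<le> f x) \<and> antimono_on {0<..} f"

definition log_plus :: "real \<Rightarrow> real" where
  "log_plus x = ln (max x 1)"

definition family :: "(real \<Rightarrow> real) \<Rightarrow> real \<Rightarrow> (real \<Rightarrow> real) set" where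
  "family g \<alpha> =
     {f. decreasing_nonneg f \<and> (\<forall>r>0. \<forall>s>0. f (r + s) \<le> g r + \<alpha> * f s)}"

definition sup_family :: "(real \<Rightarrow> real) \<Rightarrow> real \<Rightarrow> real \<Rightarrow> ereal" where
  "sup_family g \<alpha> x = (SUP f \<in> family g \<alpha>. ereal (f x))"

text \<open>
  The function \<open>F\<close> on \<open>[0,\<infinity>)\<close>. The limit at \<open>0\<close> always exists in \<^typ>\<open>ereal\<close>, because
  \<^const>\<open>sup_family\<close> is decreasing on \<open>(0,\<infinity>)\<close>.
\<close>
definition F_ext :: "(real \<Rightarrow> real) \<Rightarrow> real \<Rightarrow> real \<Rightarrow> ereal" where
  "F_ext g \<alpha> x = (if x = 0 then Lim (at_right 0) (sup_family g \<alpha>) else sup_family g \<alpha> x)"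

definition I_set :: "(real \<Rightarrow> real) \<Rightarrow> real set" where
  "I_set g = {x. 0 < x \<and> 0 < g x}"

text \<open>
  For decreasing \<open>g\<close> and \<open>x \<in> I_set g\<close> the integrand is nonnegative on \<open>(0,x)\<close>. It is integrable
  there whenever \<open>log_plus \<circ> g\<close> has a finite integral over \<open>(0,1)\<close>, so the convention that
  non-integrable functions have integral \<open>0\<close> plays no role.
\<close>
definition G_fun :: "(real \<Rightarrow> real) \<Rightarrow> real \<Rightarrow> real" where
  "G_fun g x = (LBINT t:{0<..<x}. ln (g t / g x))"

definition left_lim :: "(real \<Rightarrow> real) \<Rightarrow> real \<Rightarrow> real" where
  "left_lim g x = Lim (at_left x) g"

end

theory Submission
  imports Defs
begin

text \<open>
  Fix \<open>f\<close> in the family, \<open>\<beta>\<close> strictly between \<open>\<alpha>\<close> and \<open>1\<close>, and put \<open>v = f s\<close>. The inequality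
  \<open>f s \<le> g r + \<alpha> f (s - r)\<close> is read backwards: if \<open>r\<close> is so large that
  \<open>g r \<le> (\<beta> - \<alpha>) v / \<beta>\<close>, then \<open>f (s - r) \<ge> v / \<beta>\<close>. Thus moving left by \<open>r\<close> multiplies the value
  by at least \<open>1 / \<beta>\<close>. If this can be repeated for ever with a total displacement that stays
  below \<open>s\<close> by a fixed amount, then \<open>f\<close> is infinite at some positive point, which is absurd.

  With \<open>w = (\<beta> - \<alpha>) v\<close>, the \<open>k\<close>-th displacement need only exceed slightly the length of the
  interval on which \<open>g > w / \<beta>\<^sup>k\<close>. Weighted by \<open>ln (1 / \<beta>)\<close>, the sum of these lengths is a
  discretised layer-cake formula, hence at most the integral of \<open>log\<^sup>+ (g / w)\<close> over the
  positive half-line, called \<open>log_excess g w\<close> below. This gives the key lemma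
  \<open>family_less_of_log_excess\<close>: if \<open>log_excess g ((\<beta> - \<alpha>) v) < s ln (1 / \<beta>)\<close>, then \<open>f s < v\<close>,
  for all \<open>f\<close> in the family simultaneously.

  Both assertions follow. The logarithmic excess tends to \<open>0\<close> as \<open>w \<rightarrow> \<infinity>\<close> by dominated
  convergence, so at every \<open>s > 0\<close> some \<open>v\<close> bounds the family. For the quantitative bound,
  \<open>log_excess g w\<close> is compared with \<open>G x\<close>: if \<open>w > g x\<close>, it is either \<open>0\<close> or strictly smaller than
  \<open>G x\<close>, because \<open>ln (g / g x)\<close> exceeds \<open>ln (g / w)\<close> by a positive constant wherever \<open>g > w\<close>.
  So \<open>f s > g x / (\<beta> - \<alpha>)\<close> is impossible when \<open>s > 0\<close> and \<open>s \<ge> G x / ln (1 / \<beta>)\<close>. Taking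
  \<open>s = G x / ln (1 / \<beta>)\<close>, or letting \<open>s\<close> tend to \<open>0\<close> if \<open>G x = 0\<close>, bounds \<open>F\<close>
  by \<open>g x / (\<beta> - \<alpha>)\<close>, and \<open>g x\<close> is at most the left limit of \<open>g\<close> at \<open>x\<close>.
\<close>

section \<open>Iterating the functional inequality backwards\<close>

text \<open>
  If \<open>g r\<close> takes up at most the share \<open>(\<beta> - \<alpha>) / \<beta>\<close> of \<open>v\<close>, then \<open>\<alpha> f (s - r)\<close> has to supply the
  remaining share \<open>\<alpha> / \<beta>\<close>.
\<close>
lemma family_backward_step:
  fixes g f :: "real \<Rightarrow> real"
  assumes f: "f \<in> family g \<alpha>" and ab: "0 < \<alpha>" "\<alpha> < \<beta>"
    and r: "0 < r" "r < s" and v: "v \<le> f s" and g: "g r \<le> (\<beta> - \<alpha>) * v / \<beta>"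
  shows "v / \<beta> \<le> f (s - r)"
proof -
  have "\<forall>r>0. \<forall>s>0. f (r + s) \<le> g r + \<alpha> * f s"
    using f by (simp add: family_def)
  then have "f (r + (s - r)) \<le> g r + \<alpha> * f (s - r)"
    using r by (metis diff_gt_0_iff_gt)
  then have "v \<le> (\<beta> - \<alpha>) * v / \<beta> + \<alpha> * f (s - r)"
    using v g by simp
  then have "\<alpha> * (v / \<beta>) \<le> \<alpha> * f (s - r)"
    using ab by (simp add: field_simps)
  then show ?thesis using ab(1) by (rule mult_left_le_imp_le)
qed

lemma family_backward_steps:
  fixes g f :: "real \<Rightarrow> real"
  assumes f: "f \<in> family g \<alpha>" and ab: "0 < \<alpha>" "\<alpha> < \<beta>"
    and r: "\<And>k. 0 < r k" and g: "\<And>k. g (r k) \<le> (\<beta> - \<alpha>) * v / \<beta> ^ Suc k"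
    and v: "v \<le> f s" and s: "(\<Sum>k<n. r k) < s"
  shows "v / \<beta> ^ n \<le> f (s - (\<Sum>k<n. r k))"
  using s
proof (induction n)
  case 0
  then show ?case using v by simp
next
  case (Suc n)
  have lt: "(\<Sum>k<n. r k) < s" using Suc.prems r[of n] by simp
  have "v / \<beta> ^ n / \<beta> \<le> f (s - (\<Sum>k<n. r k) - r n)"
  proof (rule family_backward_step[OF f ab r])
    show "r n < s - (\<Sum>k<n. r k)" using Suc.prems by simp
    show "v / \<beta> ^ n \<le> f (s - (\<Sum>k<n. r k))" using Suc.IH[OF lt] .
    show "g (r n) \<le> (\<beta> - \<alpha>) * (v / \<beta> ^ n) / \<beta>" using g[of n] by (simp add: mult.commute)
  qed
  then show ?case by (simp add: algebra_simps)
qed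

section \<open>The logarithmic excess\<close>

definition log_excess :: "(real \<Rightarrow> real) \<Rightarrow> real \<Rightarrow> ennreal" where
  "log_excess g w = (\<integral>\<^sup>+t\<in>{0<..}. ennreal (log_plus (g t / w)) \<partial>lborel)"

lemma log_plus_nonneg: "0 \<le> log_plus x"
  by (simp add: log_plus_def)

lemma log_plus_mono: "x \<le> y \<Longrightarrow> log_plus x \<le> log_plus y"
  by (simp add: log_plus_def)

lemma ln_le_log_plus: "0 < x \<Longrightarrow> ln x \<le> log_plus x"
  by (simp add: log_plus_def)

lemma decreasing_nonnegD: "decreasing_nonneg g \<Longrightarrow> 0 < x \<Longrightarrow> x \<le> y \<Longrightarrow> g y \<le> g x"
  by (simp add: decreasing_nonneg_def monotone_on_def)

lemma level_set_borel:
  assumes "decreasing_nonneg g"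
  shows "{t. 0 < t \<and> a < g t} \<in> sets borel"
  by (rule real_interval_borel_measurable)
    (auto simp: is_interval_1 intro: less_le_trans decreasing_nonnegD[OF assms])

lemma log_plus_measurable [measurable]: "log_plus \<in> borel_measurable borel"
  unfolding log_plus_def[abs_def] by measurable

lemma decreasing_nonneg_measurable:
  assumes "decreasing_nonneg g"
  shows "(\<lambda>t. indicator {0<..} t * g t) \<in> borel_measurable borel"
proof -
  have "mono_on {0<..} (\<lambda>t. - g t)"
    by (auto intro!: mono_onI decreasing_nonnegD[OF assms])
  then have "(\<lambda>t. - (- g t)) \<in> borel_measurable (restrict_space borel {0<..})"
    by (intro borel_measurable_uminus borel_measurable_mono_on_fnc)
  then show ?thesis
    by (simp add: borel_measurable_restrict_space_iff)
qed

text \<open>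
  Nothing is known about \<open>g\<close> on the nonpositive reals, so measurability is available only after
  cutting off by a set of positive numbers.
\<close>
lemma measurable_comp_decreasing:
  fixes h :: "real \<Rightarrow> ennreal"
  assumes "decreasing_nonneg g" and A: "A \<in> sets borel" "\<And>t. t \<in> A \<Longrightarrow> 0 < t"
    and [measurable]: "h \<in> borel_measurable borel"
  shows "(\<lambda>t. h (g t) * indicator A t) \<in> borel_measurable borel"
proof -
  note [measurable] = decreasing_nonneg_measurable[OF assms(1)] A(1)
  have "(\<lambda>t. h (indicator {0<..} t * g t) * indicator A t) \<in> borel_measurable borel"
    by measurable
  also have "(\<lambda>t. h (indicator {0<..} t * g t) * indicator A t) = (\<lambda>t. h (g t) * indicator A t)"
    using A(2) by (force simp: indicator_def)
  finally show ?thesis .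
qed

text \<open>
  The levels \<open>1 / \<beta>\<^sup>k\<close> with \<open>k \<ge> 1\<close> are equally spaced by \<open>ln (1 / \<beta>)\<close> on the logarithmic scale,
  and the \<open>k\<close>-th lies at height \<open>k ln (1 / \<beta>)\<close>; so if \<open>k\<close> of them are below \<open>u\<close>, then \<open>ln u\<close>
  is at least \<open>k ln (1 / \<beta>)\<close>. Starting at \<open>k = 1\<close> is what makes this an upper bound without an
  additional term.
\<close>
lemma sum_log_levels_le_log_plus:
  fixes \<beta> u :: real
  assumes b: "0 < \<beta>" "\<beta> < 1"
  shows "(\<Sum>k<n. if 1 / \<beta> ^ Suc k < u then ln (1 / \<beta>) else 0) \<le> log_plus u"
proof (induction n)
  case 0
  then show ?case by (simp add: log_plus_nonneg)
next
  case (Suc n)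
  show ?case
  proof (cases "1 / \<beta> ^ Suc n < u")
    case True
    have "(\<Sum>k<Suc n. if 1 / \<beta> ^ Suc k < u then ln (1 / \<beta>) else 0) \<le> (\<Sum>k<Suc n. ln (1 / \<beta>))"
      using b by (intro sum_mono) auto
    also have "\<dots> = ln (1 / \<beta> ^ Suc n)"
      using b ln_realpow[of "1 / \<beta>" "Suc n"] by (simp add: power_one_over)
    also have "\<dots> \<le> ln u"
      using b True by (intro ln_mono) auto
    also have "\<dots> \<le> log_plus u"
      using b True by (intro ln_le_log_plus) (auto intro: less_trans[rotated])
    finally show ?thesis .
  next
    case False
    then show ?thesis using Suc.IH by simp
  qed
qed

text \<open>
  The integrated form of the preceding count, applied at each \<open>t\<close> to \<open>u = g t / w\<close>.
\<close>
lemma sum_level_measures_le_log_excess: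
  assumes g: "decreasing_nonneg g" and w: "0 < w" and b: "0 < \<beta>" "\<beta> < 1"
  shows "(\<Sum>k<n. ennreal (ln (1 / \<beta>)) * emeasure lborel {t. 0 < t \<and> w / \<beta> ^ Suc k < g t})
           \<le> log_excess g w"
proof -
  let ?S = "\<lambda>k. {t. 0 < t \<and> w / \<beta> ^ Suc k < g t}"
  have S [measurable]: "?S k \<in> sets lborel" for k
    using level_set_borel[OF g] by simp
  have L: "0 \<le> ln (1 / \<beta>)" using b by simp
  have "(\<Sum>k<n. ennreal (ln (1 / \<beta>)) * emeasure lborel (?S k))
      = (\<Sum>k<n. \<integral>\<^sup>+t. ennreal (ln (1 / \<beta>)) * indicator (?S k) t \<partial>lborel)"
    by (intro sum.cong refl nn_integral_cmult_indicator[symmetric] S)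
  also have "\<dots> = (\<integral>\<^sup>+t. (\<Sum>k<n. ennreal (ln (1 / \<beta>)) * indicator (?S k) t) \<partial>lborel)"
    by (intro nn_integral_sum[symmetric]) measurable
  also have "\<dots> \<le> log_excess g w"
    unfolding log_excess_def
  proof (rule nn_integral_mono)
    fix t :: real
    show "(\<Sum>k<n. ennreal (ln (1 / \<beta>)) * indicator (?S k) t)
        \<le> ennreal (log_plus (g t / w)) * indicator {0<..} t"
    proof (cases "0 < t")
      case True
      have "(\<Sum>k<n. ennreal (ln (1 / \<beta>)) * indicator (?S k) t)
          = (\<Sum>k<n. ennreal (if 1 / \<beta> ^ Suc k < g t / w then ln (1 / \<beta>) else 0))"
        using True w b by (intro sum.cong refl) (auto simp: field_simps indicator_def)
      also have "\<dots> = ennreal (\<Sum>k<n. if 1 / \<beta> ^ Suc k < g t / w then ln (1 / \<beta>) else 0)"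
        using L by (intro sum_ennreal) auto
      also have "\<dots> \<le> ennreal (log_plus (g t / w))"
        by (intro ennreal_leI sum_log_levels_le_log_plus b)
      finally show ?thesis using True by simp
    qed simp
  qed
  finally show ?thesis .
qed

text \<open>
  A level set of a decreasing function is an interval starting at \<open>0\<close>, so its measure is the
  point after which the level is no longer exceeded. At that point itself the level may still be
  exceeded, as \<open>g\<close> need not be right-continuous; hence the strict inequality for \<open>r\<close>.
\<close>
lemma decreasing_le_beyond_level_measure:
  assumes g: "decreasing_nonneg g" and fin: "emeasure lborel {t. 0 < t \<and> a < g t} < \<infinity>"
    and r: "measure lborel {t. 0 < t \<and> a < g t} < r"
  shows "g r \<le> a"
proof (rule ccontr)
  assume "\<not> g r \<le> a"
  let ?S = "{t. 0 < t \<and> a < g t}"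
  have r0: "0 < r" using r measure_nonneg[of lborel ?S] by linarith
  have "a < g t" if "0 < t" "t \<le> r" for t
    using \<open>\<not> g r \<le> a\<close> decreasing_nonnegD[OF g that] by simp
  then have "{0<..r} \<subseteq> ?S" by auto
  moreover have "?S \<in> fmeasurable lborel"
    using level_set_borel[OF g] fin by (intro fmeasurableI) auto
  ultimately have "measure lborel {0<..r} \<le> measure lborel ?S"
    by (intro measure_mono_fmeasurable) auto
  then show False using r r0 by simp
qed

text \<open>
  If \<open>v \<le> f s\<close>, the backward iteration with displacements just above the level measures never
  goes below a fixed \<open>e > 0\<close>, and so it would make \<open>f e\<close> larger than every \<open>v / \<beta>\<^sup>n\<close>. The
  strictness of the hypothesis on the logarithmic excess provides the room both for \<open>e\<close> and for
  enlarging the displacements.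
\<close>
lemma family_less_of_log_excess:
  assumes g: "decreasing_nonneg g" and ab: "0 < \<alpha>" "\<alpha> < \<beta>" "\<beta> < 1"
    and f: "f \<in> family g \<alpha>" and v: "0 < v" and s: "0 < s"
    and J: "log_excess g ((\<beta> - \<alpha>) * v) < ennreal (s * ln (1 / \<beta>))"
  shows "f s < v"
proof (rule ccontr)
  assume "\<not> f s < v"
  then have vf: "v \<le> f s" by simp
  define L where "L = ln (1 / \<beta>)"
  define w where "w = (\<beta> - \<alpha>) * v"
  define S where "S = (\<lambda>k. {t. 0 < t \<and> w / \<beta> ^ Suc k < g t})"
  have L: "0 < L" and w: "0 < w" and b: "0 < \<beta>"
    using ab v by (auto simp: L_def w_def ln_div)
  obtain j where j: "0 \<le> j" "log_excess g w = ennreal j" "j < s * L"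
    using J unfolding w_def[symmetric] L_def[symmetric]
    by (cases "log_excess g w" rule: ennreal_cases)
      (auto simp: ennreal_less_iff)
  have le: "(\<Sum>k<n. ennreal L * emeasure lborel (S k)) \<le> ennreal j" for n
    using sum_level_measures_le_log_excess[OF g w b ab(3), of n] unfolding L_def S_def j(2) .
  have fin: "emeasure lborel (S k) < \<infinity>" for k
  proof -
    have "ennreal L * emeasure lborel (S k) \<le> (\<Sum>i<Suc k. ennreal L * emeasure lborel (S i))"
      by (rule member_le_sum) auto
    also have "\<dots> \<le> ennreal j" by (rule le)
    finally have "ennreal L * emeasure lborel (S k) < \<infinity>"
      using le_less_trans by fastforce
    then show ?thesis using L by (auto simp: ennreal_mult_less_top)
  qed
  have sum_le: "(\<Sum>k<n. measure lborel (S k)) \<le> j / L" for n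
  proof -
    have "ennreal (\<Sum>k<n. L * measure lborel (S k)) = (\<Sum>k<n. ennreal L * emeasure lborel (S k))"
      using L fin by (subst sum_ennreal[symmetric])
        (auto simp: ennreal_mult emeasure_eq_ennreal_measure less_top intro!: sum.cong)
    also have "\<dots> \<le> ennreal j" by (rule le)
    finally have "(\<Sum>k<n. L * measure lborel (S k)) \<le> j"
      using j(1) by (simp add: ennreal_le_iff)
    then show ?thesis using L by (simp add: sum_distrib_left[symmetric] field_simps)
  qed
  \<comment> \<open>Half of the spare length \<open>s - j / L\<close> is spread over the displacements, half is kept as
    distance from \<open>0\<close>.\<close>
  define e where "e = (s - j / L) / 2"
  have e: "0 < e" using j L by (simp add: e_def field_simps)
  define r where "r = (\<lambda>k. measure lborel (S k) + e * (1 / 2) ^ Suc k)"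
  have r0: "0 < r k" for k
    using e by (simp add: r_def add_nonneg_pos)
  have gr: "g (r k) \<le> (\<beta> - \<alpha>) * v / \<beta> ^ Suc k" for k
    unfolding w_def[symmetric]
    by (rule decreasing_le_beyond_level_measure[OF g])
      (use fin[of k] e in \<open>auto simp: S_def r_def\<close>)
  have geo: "(\<Sum>k<n. e * (1 / 2) ^ Suc k) = e * (1 - (1 / 2) ^ n)" for n
    by (induction n) (auto simp: algebra_simps)
  have sum_r: "(\<Sum>k<n. r k) \<le> s - e" for n
  proof -
    have "(\<Sum>k<n. r k) = (\<Sum>k<n. measure lborel (S k)) + e * (1 - (1 / 2) ^ n)"
      unfolding r_def sum.distrib geo ..
    also have "e * (1 - (1 / 2) ^ n) \<le> e" using e by (simp add: mult_le_cancel_left1)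
    finally show ?thesis using sum_le[of n] by (simp add: e_def field_simps)
  qed
  obtain n where n: "f e / v < (1 / \<beta>) ^ n"
    using real_arch_pow[of "1 / \<beta>"] b ab by auto
  have "v / \<beta> ^ n \<le> f (s - (\<Sum>k<n. r k))"
    using sum_r[of n] e by (intro family_backward_steps[OF f ab(1,2) r0 gr vf]) simp
  also have "\<dots> \<le> f e"
    using f e sum_r[of n] unfolding family_def by (auto intro: decreasing_nonnegD)
  finally show False
    using n v b by (simp add: power_one_over field_simps)
qed

section \<open>Finiteness\<close>

text \<open>
  From \<open>w = g 1\<close> on, the integrand vanishes outside \<open>(0,1)\<close>, and for \<open>w \<ge> 1\<close> it is dominated there
  by \<open>log\<^sup>+ g\<close>. The levels \<open>g 1 + 1 + n\<close> satisfy both requirements.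
\<close>
lemma log_excess_tendsto_0:
  assumes g: "decreasing_nonneg g"
    and int: "(\<integral>\<^sup>+x\<in>{0<..<1}. ennreal (log_plus (g x)) \<partial>lborel) < \<infinity>"
  shows "(\<lambda>n. log_excess g (g 1 + 1 + real n)) \<longlonglongrightarrow> 0"
proof -
  let ?w = "\<lambda>n. g 1 + 1 + real n"
  have g1: "0 \<le> g 1" using g by (simp add: decreasing_nonneg_def)
  have small: "log_plus y = 0" if "y \<le> 1" for y
    using that by (simp add: log_plus_def max_def)
  have "(\<lambda>n. log_excess g (?w n)) \<longlonglongrightarrow> (\<integral>\<^sup>+(t::real). 0 \<partial>lborel)"
    unfolding log_excess_def
  proof (rule nn_integral_dominated_convergence
      [where w = "\<lambda>x. ennreal (log_plus (g x)) * indicator {0<..<1} x", OF _ _ _ _ int])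
    show "(\<lambda>t. ennreal (log_plus (g t / ?w n)) * indicator {0<..} t) \<in> borel_measurable lborel" for n
      using measurable_comp_decreasing[OF g, of "{0<..}" "\<lambda>y. ennreal (log_plus (y / ?w n))"] by simp
    show "(\<lambda>x. ennreal (log_plus (g x)) * indicator {0<..<1} x) \<in> borel_measurable lborel"
      using measurable_comp_decreasing[OF g, of "{0<..<1}" "\<lambda>y. ennreal (log_plus y)"] by simp
    have "ennreal (log_plus (g t / ?w n)) * indicator {0<..} t
        \<le> ennreal (log_plus (g t)) * indicator {0<..<1} t" for n t
    proof (cases "0 < t \<and> t < 1")
      case True
      then have "0 \<le> g t" using g by (simp add: decreasing_nonneg_def)
      then have "g t / ?w n \<le> g t / 1" using g1 by (intro divide_left_mono) auto
      then show ?thesis using True by (simp add: ennreal_leI log_plus_mono)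
    next
      case False
      then have "0 < t \<Longrightarrow> g t / ?w n \<le> 1"
        using decreasing_nonnegD[OF g, of 1 t] g1 by simp
      then show ?thesis using False by (auto simp: small)
    qed
    then show "AE t in lborel. ennreal (log_plus (g t / ?w n)) * indicator {0<..} t
        \<le> ennreal (log_plus (g t)) * indicator {0<..<1} t" for n
      by simp
    have "(\<lambda>n. ennreal (log_plus (g t / ?w n)) * indicator {0<..} t) \<longlonglongrightarrow> 0" for t
    proof (rule tendsto_eventually)
      obtain N where N: "g t < real N" using reals_Archimedean2 by blast
      show "\<forall>\<^sub>F n in sequentially. ennreal (log_plus (g t / ?w n)) * indicator {0<..} t = 0"
        using eventually_ge_at_top[of N]
      proof eventually_elim
        case (elim n)
        then have "g t / ?w n \<le> 1" using N g1 by simp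
        then show ?case by (simp add: small)
      qed
    qed
    then show "AE t in lborel. (\<lambda>n. ennreal (log_plus (g t / ?w n)) * indicator {0<..} t) \<longlonglongrightarrow> 0"
      by simp
  qed simp
  then show ?thesis by simp
qed

text \<open>
  The bound \<open>v\<close> depends on \<open>x\<close>, \<open>g\<close> and \<open>\<beta>\<close> but not on \<open>f\<close>. Any \<open>\<beta>\<close> between \<open>\<alpha>\<close> and \<open>1\<close> serves;
  the midpoint is a convenient choice.
\<close>
lemma sup_family_finite:
  assumes g: "decreasing_nonneg g" and a: "0 < \<alpha>" "\<alpha> < 1"
    and int: "(\<integral>\<^sup>+x\<in>{0<..<1}. ennreal (log_plus (g x)) \<partial>lborel) < \<infinity>"
    and x: "0 < x"
  shows "sup_family g \<alpha> x < \<infinity>"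
proof -
  define \<beta> where "\<beta> = (1 + \<alpha>) / 2"
  have b: "\<alpha> < \<beta>" "\<beta> < 1" using a by (auto simp: \<beta>_def)
  have g1: "0 \<le> g 1" using g by (simp add: decreasing_nonneg_def)
  have "0 < x * ln (1 / \<beta>)" using x a b by simp
  then have "0 < ennreal (x * ln (1 / \<beta>))" by simp
  from order_tendstoD(2)[OF log_excess_tendsto_0[OF g int] this]
  obtain n where n: "log_excess g (g 1 + 1 + real n) < ennreal (x * ln (1 / \<beta>))"
    by (auto simp: eventually_sequentially)
  define v where "v = (g 1 + 1 + real n) / (\<beta> - \<alpha>)"
  have v: "0 < v" "(\<beta> - \<alpha>) * v = g 1 + 1 + real n"
    using b g1 by (auto simp: v_def)
  have "f x < v" if "f \<in> family g \<alpha>" for f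
    by (rule family_less_of_log_excess[OF g a(1) b that v(1) x]) (simp add: v n)
  then have "sup_family g \<alpha> x \<le> ereal v"
    unfolding sup_family_def by (intro SUP_least) (simp add: less_imp_le)
  then show ?thesis by auto
qed

section \<open>The quantitative bound\<close>

text \<open>
  The comparison with \<open>log_excess\<close> takes place among integrals in the extended nonnegative
  numbers, so \<open>G\<close> is identified with such an integral first. The point is finiteness:
  near \<open>0\<close> the integrand is at most \<open>log\<^sup>+ g\<close> plus a constant, and beyond \<open>1\<close> it is bounded.
\<close>
lemma G_fun_eq_nn_integral:
  assumes g: "decreasing_nonneg g" and x: "x \<in> I_set g"
    and int: "(\<integral>\<^sup>+x\<in>{0<..<1}. ennreal (log_plus (g x)) \<partial>lborel) < \<infinity>"
  shows "(\<integral>\<^sup>+t\<in>{0<..<x}. ennreal (ln (g t / g x)) \<partial>lborel) = ennreal (G_fun g x)"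
    and "0 \<le> G_fun g x"
proof -
  have x0: "0 < x" and gx: "0 < g x" using x by (auto simp: I_set_def)
  have ge: "g x \<le> g t" if "0 < t" "t < x" for t
    using that decreasing_nonnegD[OF g, of t x] by simp
  define C where "C = log_plus (g 1) + \<bar>ln (g x)\<bar>"
  have C: "0 \<le> C" by (simp add: C_def log_plus_nonneg)
  let ?N = "\<integral>\<^sup>+t\<in>{0<..<x}. ennreal (ln (g t / g x)) \<partial>lborel"
  have [measurable]: "(\<lambda>t. ennreal (log_plus (g t)) * indicator {0<..<1} t) \<in> borel_measurable borel"
    using measurable_comp_decreasing[OF g, of "{0<..<1}" "\<lambda>y. ennreal (log_plus y)"] by simp
  have "?N \<le> (\<integral>\<^sup>+t. ennreal (log_plus (g t)) * indicator {0<..<1} t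
                  + ennreal C * indicator {0<..<x} t \<partial>lborel)"
  proof (rule nn_integral_mono)
    fix t :: real
    show "ennreal (ln (g t / g x)) * indicator {0<..<x} t
        \<le> ennreal (log_plus (g t)) * indicator {0<..<1} t + ennreal C * indicator {0<..<x} t"
    proof (cases "0 < t \<and> t < x")
      case True
      then have gt: "0 < g t" using ge[of t] gx by simp
      have ln: "ln (g t / g x) = ln (g t) - ln (g x)" using gt gx by (simp add: ln_div)
      show ?thesis
      proof (cases "t < 1")
        case True1: True
        have "ln (g t / g x) \<le> log_plus (g t) + C"
          unfolding ln C_def using ln_le_log_plus[OF gt] log_plus_nonneg[of "g 1"] by linarith
        then have "ennreal (ln (g t / g x)) \<le> ennreal (log_plus (g t)) + ennreal C"
          using C log_plus_nonneg[of "g t"] ennreal_leI by (metis ennreal_plus)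
        then show ?thesis using True True1 by simp
      next
        case False
        have "log_plus (g t) \<le> log_plus (g 1)"
          using False decreasing_nonnegD[OF g, of 1 t] by (intro log_plus_mono) simp
        then have "ln (g t / g x) \<le> C"
          unfolding ln C_def using ln_le_log_plus[OF gt] by linarith
        then show ?thesis using True False by (simp add: ennreal_leI)
      qed
    qed simp
  qed
  also have "\<dots> = (\<integral>\<^sup>+t\<in>{0<..<1}. ennreal (log_plus (g t)) \<partial>lborel) + ennreal C * ennreal x"
    using x0 by (subst nn_integral_add) (auto simp: nn_integral_cmult_indicator)
  also have "\<dots> < \<infinity>"
    using int by (simp add: ennreal_mult_less_top)
  finally have fin: "?N < \<infinity>" .
  have meas: "(\<lambda>t. indicator {0<..<x} t * ln (g t / g x)) \<in> borel_measurable borel"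
  proof -
    note [measurable] = decreasing_nonneg_measurable[OF g]
    have "(\<lambda>t. indicator {0<..<x} t * ln ((indicator {0<..} t * g t) / g x)) \<in> borel_measurable borel"
      by measurable
    also have "(\<lambda>t. indicator {0<..<x} t * ln ((indicator {0<..} t * g t) / g x))
        = (\<lambda>t. indicator {0<..<x} t * ln (g t / g x))"
      by (force simp: indicator_def)
    finally show ?thesis .
  qed
  have nonneg: "0 \<le> indicator {0<..<x} t * ln (g t / g x)" for t
    using ge[of t] gx by (auto simp: indicator_def)
  have "G_fun g x = enn2real (\<integral>\<^sup>+t. ennreal (indicator {0<..<x} t * ln (g t / g x)) \<partial>lborel)"
    unfolding G_fun_def set_lebesgue_integral_def real_scaleR_def
    using meas nonneg by (intro integral_eq_nn_integral) auto
  also have "(\<integral>\<^sup>+t. ennreal (indicator {0<..<x} t * ln (g t / g x)) \<partial>lborel) = ?N"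
    by (intro nn_integral_cong) (auto simp: indicator_def)
  finally have "G_fun g x = enn2real ?N" .
  then show "?N = ennreal (G_fun g x)" "0 \<le> G_fun g x"
    using fin by (auto simp: less_top)
qed

text \<open>
  On \<open>{g > w}\<close>, which lies to the left of \<open>x\<close>, the identity
  \<open>ln (g t / g x) = ln (g t / w) + ln (w / g x)\<close> holds; elsewhere the left-hand integrand is \<open>0\<close>.
\<close>
lemma log_excess_add_level_le:
  assumes g: "decreasing_nonneg g" and gx: "0 < x" "0 < g x" and w: "g x < w"
  shows "log_excess g w + ennreal (ln (w / g x)) * emeasure lborel {t. 0 < t \<and> w < g t}
           \<le> (\<integral>\<^sup>+t\<in>{0<..<x}. ennreal (ln (g t / g x)) \<partial>lborel)"
proof -
  let ?S = "{t. 0 < t \<and> w < g t}"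
  have S [measurable]: "?S \<in> sets borel" by (rule level_set_borel[OF g])
  have [measurable]: "(\<lambda>t. ennreal (log_plus (g t / w)) * indicator {0<..} t) \<in> borel_measurable borel"
    using measurable_comp_decreasing[OF g, of "{0<..}" "\<lambda>y. ennreal (log_plus (y / w))"] by simp
  have "log_excess g w + ennreal (ln (w / g x)) * emeasure lborel ?S
      = (\<integral>\<^sup>+t. ennreal (log_plus (g t / w)) * indicator {0<..} t
               + ennreal (ln (w / g x)) * indicator ?S t \<partial>lborel)"
    unfolding log_excess_def by (subst nn_integral_add) (auto simp: nn_integral_cmult_indicator)
  also have "\<dots> \<le> (\<integral>\<^sup>+t\<in>{0<..<x}. ennreal (ln (g t / g x)) \<partial>lborel)"
  proof (rule nn_integral_mono)
    fix t :: real
    show "ennreal (log_plus (g t / w)) * indicator {0<..} t + ennreal (ln (w / g x)) * indicator ?S t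
        \<le> ennreal (ln (g t / g x)) * indicator {0<..<x} t"
    proof (cases "t \<in> ?S")
      case True
      then have t: "0 < t" "w < g t" by auto
      have "t < x"
        using t w gx decreasing_nonnegD[OF g, of x t] by (cases "t < x") auto
      moreover have "log_plus (g t / w) = ln (g t / w)"
        using t w gx by (simp add: log_plus_def max_def field_simps)
      moreover have "ln (g t / w) + ln (w / g x) = ln (g t / g x)"
        using t w gx by (simp add: ln_div)
      moreover have "0 \<le> ln (g t / w)" "0 \<le> ln (w / g x)"
        using t w gx by (auto simp: field_simps)
      ultimately show ?thesis
        using True by (simp add: ennreal_plus[symmetric] del: ennreal_plus)
    next
      case False
      then have "0 < t \<Longrightarrow> g t / w \<le> 1" using w gx by auto
      then have "0 < t \<Longrightarrow> log_plus (g t / w) = 0" by (simp add: log_plus_def max_def)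
      then show ?thesis using False by (auto simp: indicator_def)
    qed
  qed
  finally show ?thesis .
qed

text \<open>
  The key lemma requires the strict inequality \<open>log_excess g w < s ln (1 / \<beta>)\<close>, whereas \<open>s\<close> may
  equal \<open>G x / ln (1 / \<beta>)\<close>. Strictness comes from the level set \<open>{g > w}\<close>: if it has positive
  measure, \<open>log_excess g w < G x\<close>; if it is null, then \<open>log_excess g w = 0\<close> and \<open>s > 0\<close> suffices.
\<close>
lemma family_le_of_G_fun:
  assumes g: "decreasing_nonneg g" and ab: "0 < \<alpha>" "\<alpha> < \<beta>" "\<beta> < 1"
    and int: "(\<integral>\<^sup>+x\<in>{0<..<1}. ennreal (log_plus (g x)) \<partial>lborel) < \<infinity>"
    and x: "x \<in> I_set g" and s: "0 < s" "G_fun g x / ln (1 / \<beta>) \<le> s"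
    and f: "f \<in> family g \<alpha>"
  shows "f s \<le> g x / (\<beta> - \<alpha>)"
proof (rule ccontr)
  assume neg: "\<not> f s \<le> g x / (\<beta> - \<alpha>)"
  have gx: "0 < x" "0 < g x" using x by (auto simp: I_set_def)
  define w where "w = (\<beta> - \<alpha>) * f s"
  have w: "g x < w" using neg ab by (simp add: w_def field_simps)
  have "0 < g x / (\<beta> - \<alpha>)" using gx ab by simp
  then have v: "0 < f s" using neg by linarith
  have L: "0 < ln (1 / \<beta>)" using ab by (simp add: ln_div)
  let ?S = "{t. 0 < t \<and> w < g t}"
  have le: "log_excess g w + ennreal (ln (w / g x)) * emeasure lborel ?S \<le> ennreal (G_fun g x)"
    using log_excess_add_level_le[OF g gx w] unfolding G_fun_eq_nn_integral(1)[OF g x int] .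
  have "log_excess g w < ennreal (s * ln (1 / \<beta>))"
  proof (cases "emeasure lborel ?S = 0")
    case True
    have "AE t in lborel. t \<notin> ?S"
      using True level_set_borel[OF g] by (intro AE_not_in) (auto simp: null_sets_def)
    then have "log_excess g w = (\<integral>\<^sup>+(t::real). 0 \<partial>lborel)"
      unfolding log_excess_def
    proof (intro nn_integral_cong_AE, eventually_elim)
      fix t assume "t \<notin> ?S"
      then have "0 < t \<Longrightarrow> g t / w \<le> 1" using w gx by auto
      then show "ennreal (log_plus (g t / w)) * indicator {0<..} t = 0"
        by (auto simp: log_plus_def max_def indicator_def)
    qed
    then show ?thesis using s L by simp
  next
    case False
    have "0 < ln (w / g x)" using w gx by (simp add: field_simps)
    then have pos: "0 < ennreal (ln (w / g x)) * emeasure lborel ?S"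
      using False by (simp add: ennreal_zero_less_mult_iff zero_less_iff_neq_zero)
    have "log_excess g w \<le> ennreal (G_fun g x)"
      using le by (rule order_trans[rotated]) simp
    then have "log_excess g w \<noteq> top" by (auto simp: top_unique)
    then have "log_excess g w + 0 < log_excess g w + ennreal (ln (w / g x)) * emeasure lborel ?S"
      using pos by (subst ennreal_add_left_cancel_less) auto
    also have "\<dots> \<le> ennreal (G_fun g x)" by (rule le)
    also have "\<dots> \<le> ennreal (s * ln (1 / \<beta>))"
      using s L by (intro ennreal_leI) (simp only: pos_divide_le_eq)
    finally show ?thesis by simp
  qed
  from family_less_of_log_excess[OF g ab f v s(1) this[unfolded w_def]]
  show False by simp
qed

lemma sup_family_antimono:
  assumes "0 < x" "x \<le> y"
  shows "sup_family g \<alpha> y \<le> sup_family g \<alpha> x"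
  unfolding sup_family_def
  by (rule SUP_mono) (use assms in \<open>auto simp: family_def intro: decreasing_nonnegD\<close>)

text \<open>
  \<^const>\<open>Lim\<close> is meaningful only where the limit exists, which monotonicity guarantees. The
  negation of \<open>h\<close> is increasing, as the one-sided limit theorem for monotone functions requires.
\<close>
lemma Lim_at_right_0_le:
  fixes h :: "real \<Rightarrow> ereal"
  assumes mono: "\<And>x y. 0 < x \<Longrightarrow> x \<le> y \<Longrightarrow> h y \<le> h x" and le: "\<And>x. 0 < x \<Longrightarrow> h x \<le> c"
  shows "Lim (at_right 0) h \<le> c"
proof -
  have "((\<lambda>x. - h x) \<longlongrightarrow> Inf ((\<lambda>x. - h x) ` ({0<..} \<inter> UNIV))) (at 0 within ({0<..} \<inter> UNIV))"
    by (rule Lim_right_bound[where K = "- c"]) (auto simp: assms)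
  then obtain l where l: "((\<lambda>x. - h x) \<longlongrightarrow> l) (at_right 0)" by auto
  have lim: "(h \<longlongrightarrow> - l) (at_right 0)"
    using tendsto_uminus_ereal[OF l] by simp
  then have "Lim (at_right 0) h = - l" by (intro tendsto_Lim) auto
  also have "\<dots> \<le> c"
    by (rule tendsto_upperbound[OF lim]) (auto simp: le eventually_at_filter)
  finally show ?thesis .
qed

lemma le_left_lim:
  assumes g: "decreasing_nonneg g" and x: "0 < x"
  shows "g x \<le> left_lim g x"
proof -
  have "((\<lambda>t. - g t) \<longlongrightarrow> Sup ((\<lambda>t. - g t) ` ({..<x} \<inter> {0<..}))) (at x within ({..<x} \<inter> {0<..}))"
    by (rule Lim_left_bound[where K = "- g x"]) (auto intro: decreasing_nonnegD[OF g])
  also have "at x within ({..<x} \<inter> {0<..}) = at_left x"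
    by (rule at_within_nhd[of _ "{0<..}"]) (use x in auto)
  finally obtain l where l: "((\<lambda>t. - g t) \<longlongrightarrow> l) (at_left x)" by auto
  have lim: "(g \<longlongrightarrow> - l) (at_left x)"
    using tendsto_minus[OF l] by simp
  have "eventually (\<lambda>t. g x \<le> g t) (at_left x)"
    using eventually_at_left_real[OF x] by eventually_elim (auto intro: decreasing_nonnegD[OF g])
  then have "g x \<le> - l" by (intro tendsto_lowerbound[OF lim]) auto
  also have "- l = left_lim g x"
    unfolding left_lim_def using lim by (intro tendsto_Lim[symmetric]) auto
  finally show ?thesis .
qed

text \<open>
  The case \<open>G x = 0\<close> concerns the value of \<open>F\<close> at \<open>0\<close>: there every \<open>s > 0\<close> satisfies
  \<open>s \<ge> G x / ln (1 / \<beta>)\<close>, so the bound holds on all of \<open>(0,\<infinity>)\<close> and passes to the limit.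
\<close>
theorem theorem2p1:
  fixes g :: "real \<Rightarrow> real" and \<alpha> :: real
  assumes "decreasing_nonneg g"
    and "0 < \<alpha>" and "\<alpha> < 1"
    and "(\<integral>\<^sup>+x\<in>{0<..<1}. ennreal (log_plus (g x)) \<partial>lborel) < \<infinity>"
  shows "(\<forall>x>0. sup_family g \<alpha> x < \<infinity>) \<and>
         (\<forall>x \<in> I_set g. \<forall>\<beta>. \<alpha> < \<beta> \<and> \<beta> < 1 \<longrightarrow>
            F_ext g \<alpha> (G_fun g x / ln (1 / \<beta>)) \<le> ereal (left_lim g x / (\<beta> - \<alpha>)))"
proof (intro conjI allI impI ballI)
  show "sup_family g \<alpha> x < \<infinity>" if "0 < x" for x
    using sup_family_finite[OF assms that] .
next
  fix x \<beta> assume x: "x \<in> I_set g" and "\<alpha> < \<beta> \<and> \<beta> < 1"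
  then have b: "\<alpha> < \<beta>" "\<beta> < 1" by auto
  define T where "T = G_fun g x / ln (1 / \<beta>)"
  have T: "0 \<le> T"
    using G_fun_eq_nn_integral(2)[OF assms(1) x assms(4)] assms(2) b by (simp add: T_def)
  have le: "sup_family g \<alpha> s \<le> ereal (g x / (\<beta> - \<alpha>))" if "0 < s" "T \<le> s" for s
    unfolding sup_family_def
    using family_le_of_G_fun[OF assms(1,2) b assms(4) x, of s] that
    by (auto intro!: SUP_least simp: T_def)
  have "F_ext g \<alpha> T \<le> ereal (g x / (\<beta> - \<alpha>))"
  proof (cases "T = 0")
    case True
    then show ?thesis
      using le by (auto simp: F_ext_def intro: Lim_at_right_0_le sup_family_antimono)
  next
    case False
    then show ?thesis using le[of T] T by (simp add: F_ext_def)
  qed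
  also have "\<dots> \<le> ereal (left_lim g x / (\<beta> - \<alpha>))"
    using le_left_lim[OF assms(1), of x] x b by (auto simp: I_set_def intro: divide_right_mono)
  finally show "F_ext g \<alpha> (G_fun g x / ln (1 / \<beta>)) \<le> ereal (left_lim g x / (\<beta> - \<alpha>))"
    unfolding T_def .
qed

end
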